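(* Let $p\ge 7$ be a prime and let $N,R,n,r$ be non-negative integers with $N\ge R$ and $n<p$, $r<p$. (a) If $r\le n$, then, as a congruence of $p$-integral rational numbers, $$\binom{Np^3+n}{Rp^3+r}\Big/\Big[\binom{N}{R}\binom{n}{r}\Big]\equiv 1+c(N,R,n,r;p)\,p^3\pmod{p^5},$$ where $c(N,R,n,r;p)=H_1(n)N-H_1(r)R+\big(w_pNR-H_1(n-r)\big)(N-R)$. (b) If $n<r$, then $$\binom{Np^3+n}{Rp^3+r}\Big/\binom{N}{R}\equiv (-1)^{r-n+1}\,\frac{N-R}{r}\,\binom{r-1}{n}^{-1}p^3\pmod{p^5}.$$
   Context: For a non-negative integer $m$, $H_1(m)=\sum_{k=1}^{m}\frac1k$ (with $H_1(0)=0$); for $m<p$ this is $p$-integral. For a prime $p\ge5$, Wolstenholme's theorem gives $H_1(p-1)\equiv0\pmod{p^2}$, and $w_p$ denotes the unique integer with $0\le w_p<p^2$ and $w_p\equiv H_1(p-1)/p^2\pmod{p^2}$. *)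

theory Defs
  imports Complex_Main "HOL-Computational_Algebra.Primes"
begin

definition H1 :: "nat \<Rightarrow> rat" where
  "H1 m = (\<Sum>k=1..m. 1 / of_nat k)"

definition p_integral :: "nat \<Rightarrow> rat \<Rightarrow> bool" where
  "p_integral p x \<longleftrightarrow> \<not> int p dvd snd (quotient_of x)"

(* x = y (mod p^k) in the ring of p-integral rationals; p-integrality of both sides
   is part of the assertion. *)
definition pcong :: "nat \<Rightarrow> nat \<Rightarrow> rat \<Rightarrow> rat \<Rightarrow> bool" where
  "pcong p k x y \<longleftrightarrow> p_integral p x \<and> p_integral p y \<and>
     (\<exists>z. p_integral p z \<and> x - y = of_nat p ^ k * z)"

(* Only meaningful for primes p >= 5, where the quotient is p-integral by
   Wolstenholme's theorem. *)
definition wolst :: "nat \<Rightarrow> int" where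
  "wolst p = (THE w. 0 \<le> w \<and> w < int p ^ 2 \<and>
     pcong p 2 (of_int w) (H1 (p - 1) / of_nat p ^ 2))"

definition c_coeff :: "nat \<Rightarrow> nat \<Rightarrow> nat \<Rightarrow> nat \<Rightarrow> nat \<Rightarrow> rat" where
  "c_coeff N R n r p = H1 n * of_nat N - H1 r * of_nat R
     + (of_int (wolst p) * of_nat N * of_nat R - H1 (n - r)) * (of_nat N - of_nat R)"

end

theory Submission
  imports Defs "HOL-Number_Theory.Cong"
begin

text \<open>
  Splitting \<open>(N p)!\<close> into blocks of length \<open>p\<close> writes \<open>(N p choose R p) / (N choose R)\<close> as a quotient of
  products of \<open>G j = (\<Prod>0<k<p. 1 + j p / k)\<close>. Pairing \<open>k\<close> with \<open>p - k\<close> gives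
  \<open>(G j)\<^sup>2 = (\<Prod>0<k<p. 1 + j (j + 1) p\<^sup>2 / (k (p - k)))\<close>, whose second elementary symmetric term is divisible
  by \<open>p\<^sup>5\<close> since the sums of \<open>k\<^sup>-\<^sup>2\<close> and \<open>k\<^sup>-\<^sup>4\<close> vanish modulo \<open>p \<ge> 7\<close>; hence
  \<open>G j \<equiv> 1 + j (j + 1) w p\<^sup>3\<close> modulo \<open>p\<^sup>5\<close>. Summing over \<open>j\<close> yields \<open>1 + w N R (N - R) p\<^sup>3\<close>, and the
  passages from \<open>p\<close> to \<open>p\<^sup>2\<close> and from \<open>p\<^sup>2\<close> to \<open>p\<^sup>3\<close> contribute nothing modulo \<open>p\<^sup>5\<close>. The offsets \<open>n\<close>
  and \<open>r\<close> only add factors \<open>1 + X p\<^sup>3 / k\<close>, which are multiplied modulo \<open>p\<^sup>6\<close>.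
\<close>

text \<open>Frees integrality from lowest terms: for \<open>c / d\<close> reduced and equal to
  \<open>a / b\<close>, \<open>d\<close> divides \<open>c * b\<close> and is coprime to
  \<open>c\<close>, so \<open>d\<close> divides \<open>b\<close>.\<close>

lemma p_integral_iff:
  "p_integral p x \<longleftrightarrow> (\<exists>a b. \<not> int p dvd b \<and> x = of_int a / of_int b)"
proof
  assume "p_integral p x"
  moreover have "x = of_int (fst (quotient_of x)) / of_int (snd (quotient_of x))"
    by (simp add: quotient_of_div)
  ultimately show "\<exists>a b. \<not> int p dvd b \<and> x = of_int a / of_int b"
    unfolding p_integral_def by blast
next
  assume "\<exists>a b. \<not> int p dvd b \<and> x = of_int a / of_int b"
  then obtain a b where b: "\<not> int p dvd b" and x: "x = of_int a / of_int b" by blast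
  obtain c d where q: "quotient_of x = (c, d)" by (cases "quotient_of x")
  have d: "d > 0" "coprime c d" "x = of_int c / of_int d"
    using q quotient_of_denom_pos quotient_of_coprime quotient_of_div by auto
  have "b \<noteq> 0" using b by auto
  then have "(of_int (a * d) :: rat) = of_int (c * b)"
    using x d by (simp add: field_simps)
  then have "a * d = c * b" by (simp only: of_int_eq_iff)
  then have "d dvd c * b" by (metis dvd_triv_right)
  then have "d dvd b" using d(2) by (simp add: coprime_commute coprime_dvd_mult_right_iff)
  then show "p_integral p x" using b q unfolding p_integral_def by (auto dest: dvd_trans)
qed

lemma pcong_iff:
  "pcong p k x y \<longleftrightarrow> p_integral p x \<and> p_integral p y \<and> (\<exists>z. p_integral p z \<and> x = y + of_nat p ^ k * z)"
  unfolding pcong_def by (auto simp: algebra_simps)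

section \<open>Factorials with an offset\<close>

text \<open>This is the generalized binomial coefficient \<open>x + n\<close> over \<open>n\<close>,
  written with factors that are close to 1 when \<open>x\<close> is divisible by a power of
  p.\<close>

definition shifted_prod :: "rat \<Rightarrow> nat \<Rightarrow> rat" where
  "shifted_prod x n = (\<Prod>k=1..n. 1 + x / of_nat k)"

lemma fact_add_shifted_prod:
  "(fact (m + n) :: rat) = fact m * fact n * shifted_prod (of_nat m) n"
proof (induction n)
  case (Suc n)
  have "(fact (m + Suc n) :: rat) = of_nat (m + Suc n) * fact (m + n)" by simp
  also have "\<dots> = fact m * fact (Suc n) * (shifted_prod (of_nat m) n * (1 + of_nat m / of_nat (Suc n)))"
    unfolding Suc.IH by (simp add: field_simps del: of_nat_Suc) (simp add: algebra_simps)
  finally show ?case by (simp add: shifted_prod_def)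
qed (simp add: shifted_prod_def)

text \<open>Peels off the factors \<open>m\<close>, \<open>m - 1\<close>, ..., \<open>m - d\<close>,
  with \<open>m - k = - k (1 - m / k)\<close> for positive \<open>k\<close>. The bare factor
  \<open>m\<close> later supplies the visible p^3 in the case \<open>n < r\<close>.\<close>

lemma fact_diff_shifted_prod:
  assumes "d < m"
  shows "(fact m :: rat) = fact (m - Suc d) * of_nat m * (-1) ^ d * fact d * shifted_prod (- of_nat m) d"
  using assms
proof (induction d)
  case 0
  then show ?case by (simp add: shifted_prod_def fact_reduce)
next
  case (Suc d)
  have e: "m - Suc d = Suc (m - Suc (Suc d))" using Suc.prems by simp
  have f: "(fact (m - Suc d) :: rat) = (of_nat m - of_nat (Suc d)) * fact (m - Suc (Suc d))"
    using Suc.prems unfolding e by (simp add: of_nat_diff)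
  have g: "(of_nat m - of_nat (Suc d) :: rat) = - of_nat (Suc d) * (1 + - of_nat m / of_nat (Suc d))"
    by (simp add: field_simps del: of_nat_Suc)
  have "(fact m :: rat) = fact (m - Suc d) * of_nat m * (-1) ^ d * fact d * shifted_prod (- of_nat m) d"
    using Suc by simp
  also have "\<dots> = fact (m - Suc (Suc d)) * of_nat m * (-1) ^ Suc d * (of_nat (Suc d) * fact d) *
      (shifted_prod (- of_nat m) d * (1 + - of_nat m / of_nat (Suc d)))"
    unfolding f g by (simp add: algebra_simps del: of_nat_Suc)
  also have "of_nat (Suc d) * fact d = (fact (Suc d) :: rat)" by simp
  finally show ?case by (simp add: shifted_prod_def)
qed


section \<open>The ring of p-integral rationals\<close>

context
  fixes p :: nat
  assumes p: "prime p"
begin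

lemma prime_int_p: "prime (int p)" using p by simp

lemma p_integral_of_int [simp]: "p_integral p (of_int a)"
  unfolding p_integral_iff using prime_int_p
  by (intro exI[of _ a] exI[of _ 1]) (auto simp: not_prime_unit)

lemma p_integral_of_nat [simp]: "p_integral p (of_nat a)"
  using p_integral_of_int[of "int a"] by simp

lemma p_integral_0 [simp]: "p_integral p 0" using p_integral_of_int[of 0] by simp

lemma p_integral_1 [simp]: "p_integral p 1" using p_integral_of_int[of 1] by simp

lemma p_integral_add: "p_integral p x \<Longrightarrow> p_integral p y \<Longrightarrow> p_integral p (x + y)"
proof -
  assume "p_integral p x" "p_integral p y"
  then obtain a b c d where *: "\<not> int p dvd b" "x = of_int a / of_int b"
    "\<not> int p dvd d" "y = of_int c / of_int d" unfolding p_integral_iff by blast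
  then have "b \<noteq> 0" "d \<noteq> 0" by auto
  then have "x + y = of_int (a * d + c * b) / of_int (b * d)" using * by (simp add: field_simps)
  moreover have "\<not> int p dvd b * d" using * prime_int_p by (simp add: prime_dvd_mult_iff)
  ultimately show ?thesis unfolding p_integral_iff by blast
qed

lemma p_integral_mult: "p_integral p x \<Longrightarrow> p_integral p y \<Longrightarrow> p_integral p (x * y)"
proof -
  assume "p_integral p x" "p_integral p y"
  then obtain a b c d where *: "\<not> int p dvd b" "x = of_int a / of_int b"
    "\<not> int p dvd d" "y = of_int c / of_int d" unfolding p_integral_iff by blast
  then have "x * y = of_int (a * c) / of_int (b * d)" by simp
  moreover have "\<not> int p dvd b * d" using * prime_int_p by (simp add: prime_dvd_mult_iff)
  ultimately show ?thesis unfolding p_integral_iff by blast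
qed

lemma p_integral_minus: "p_integral p x \<Longrightarrow> p_integral p (- x)"
  using p_integral_mult[of "of_int (-1)" x] p_integral_of_int[of "-1"] by simp

lemma p_integral_diff: "p_integral p x \<Longrightarrow> p_integral p y \<Longrightarrow> p_integral p (x - y)"
  using p_integral_add[of x "- y"] p_integral_minus by simp

lemma p_integral_power: "p_integral p x \<Longrightarrow> p_integral p (x ^ n)"
  by (induction n) (auto intro: p_integral_mult)

lemma p_integral_sum: "(\<And>i. i \<in> A \<Longrightarrow> p_integral p (f i)) \<Longrightarrow> p_integral p (sum f A)"
  by (induction A rule: infinite_finite_induct) (auto intro: p_integral_add)

lemma p_integral_prod: "(\<And>i. i \<in> A \<Longrightarrow> p_integral p (f i)) \<Longrightarrow> p_integral p (prod f A)"
  by (induction A rule: infinite_finite_induct) (auto intro: p_integral_mult)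

lemmas p_integral_intros = p_integral_add p_integral_mult p_integral_minus p_integral_diff
  p_integral_power p_integral_sum p_integral_prod

lemma p_integral_inverse_of_int: "\<not> int p dvd a \<Longrightarrow> p_integral p (inverse (of_int a))"
  unfolding p_integral_iff by (intro exI[of _ 1] exI[of _ a]) (auto simp: divide_inverse)

lemma p_integral_inverse_of_nat: "0 < k \<Longrightarrow> k < p \<Longrightarrow> p_integral p (inverse (of_nat k))"
  using p_integral_inverse_of_int[of "int k"] nat_dvd_not_less[of k p] by simp

lemma p_integral_divide_of_nat:
  "p_integral p x \<Longrightarrow> 0 < k \<Longrightarrow> k < p \<Longrightarrow> p_integral p (x / of_nat k)"
  unfolding divide_inverse by (intro p_integral_mult p_integral_inverse_of_nat)

text \<open>A p-integral number with nonzero residue is a unit: for \<open>t = a / b\<close> the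
  numerator \<open>c * b + p * a\<close> is prime to p.\<close>

lemma unit_of_int_plus:
  assumes "\<not> int p dvd c" "p_integral p t"
  shows "of_int c + of_nat p * t \<noteq> 0 \<and> p_integral p (inverse (of_int c + of_nat p * t))"
proof -
  obtain a b where *: "\<not> int p dvd b" "t = of_int a / of_int b"
    using assms(2) unfolding p_integral_iff by blast
  then have b: "b \<noteq> 0" by auto
  have nd: "\<not> int p dvd c * b + int p * a"
    using * assms prime_int_p dvd_add_left_iff[of "int p" "int p * a" "c * b"]
    by (simp add: prime_dvd_mult_iff)
  then have "c * b + int p * a \<noteq> 0" by auto
  moreover have e: "of_int c + of_nat p * t = of_int (c * b + int p * a) / of_int b"
    using b * by (simp add: field_simps)
  ultimately have "of_int c + of_nat p * t \<noteq> 0" using b by (simp only: divide_eq_0_iff of_int_eq_0_iff) simp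
  moreover have "p_integral p (inverse (of_int c + of_nat p * t))"
    unfolding e p_integral_iff
    using nd by (intro exI[of _ b] exI[of _ "c * b + int p * a"]) simp
  ultimately show ?thesis by blast
qed

section \<open>Arithmetic of congruences modulo p^k\<close>

lemma pcongI:
  assumes "p_integral p y" "p_integral p z" "x = y + of_nat p ^ k * z"
  shows "pcong p k x y"
  using assms unfolding pcong_iff by (auto intro!: p_integral_intros)

lemma pcongE:
  assumes "pcong p k x y"
  obtains z where "p_integral p x" "p_integral p y" "p_integral p z" "x = y + of_nat p ^ k * z"
  using assms unfolding pcong_iff by blast

lemma pcong_refl: "p_integral p x \<Longrightarrow> pcong p k x x"
  by (rule pcongI[of _ 0]) auto

lemma pcong_sym:
  assumes "pcong p k x y"
  shows "pcong p k y x"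
proof -
  obtain z where "p_integral p x" "p_integral p z" "x = y + of_nat p ^ k * z"
    using assms by (elim pcongE)
  then show ?thesis by (intro pcongI[of _ "- z"]) (auto intro: p_integral_minus)
qed

lemma pcong_trans [trans]:
  assumes "pcong p k x y" "pcong p k y z"
  shows "pcong p k x z"
proof -
  obtain u v where "p_integral p z" "p_integral p u" "p_integral p v"
    "x = y + of_nat p ^ k * u" "y = z + of_nat p ^ k * v" using assms by (elim pcongE)
  then show ?thesis
    by (intro pcongI[of _ "u + v"]) (auto intro: p_integral_intros simp: algebra_simps)
qed

lemma pcong_add:
  assumes "pcong p k x y" "pcong p k x' y'"
  shows "pcong p k (x + x') (y + y')"
proof -
  obtain u v where "p_integral p y" "p_integral p y'" "p_integral p u" "p_integral p v"
    "x = y + of_nat p ^ k * u" "x' = y' + of_nat p ^ k * v" using assms by (elim pcongE)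
  then show ?thesis
    by (intro pcongI[of _ "u + v"]) (auto intro: p_integral_intros simp: algebra_simps)
qed

lemma pcong_mult:
  assumes "pcong p k x y" "pcong p k x' y'"
  shows "pcong p k (x * x') (y * y')"
proof -
  obtain u v where "p_integral p y" "p_integral p x'" "p_integral p y'" "p_integral p u" "p_integral p v"
    "x = y + of_nat p ^ k * u" "x' = y' + of_nat p ^ k * v" using assms by (elim pcongE)
  then show ?thesis
    by (intro pcongI[of _ "u * x' + y * v"] p_integral_intros) (simp_all add: algebra_simps)
qed

lemma pcong_sum: "(\<And>i. i \<in> A \<Longrightarrow> pcong p k (f i) (g i)) \<Longrightarrow> pcong p k (sum f A) (sum g A)"
  by (induction A rule: infinite_finite_induct) (auto intro: pcong_refl pcong_add)

lemma pcong_prod: "(\<And>i. i \<in> A \<Longrightarrow> pcong p k (f i) (g i)) \<Longrightarrow> pcong p k (prod f A) (prod g A)"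
  by (induction A rule: infinite_finite_induct) (auto intro: pcong_refl pcong_mult)

lemma pcong_power: "pcong p k x y \<Longrightarrow> pcong p k (x ^ n) (y ^ n)"
  by (induction n) (auto intro: pcong_refl pcong_mult)

text \<open>For units the difference of inverses is \<open>(y - x) / (x y)\<close>, so no power of p
  is lost.\<close>

lemma pcong_inverse:
  assumes "pcong p k x y" "x \<noteq> 0" "y \<noteq> 0" "p_integral p (inverse x)" "p_integral p (inverse y)"
  shows "pcong p k (inverse x) (inverse y)"
proof -
  obtain z where z: "p_integral p z" "x = y + of_nat p ^ k * z"
    using assms(1) by (elim pcongE)
  have "inverse x = inverse y + (y - x) * inverse x * inverse y"
    using assms(2,3) by (simp add: field_simps)
  also have "y - x = of_nat p ^ k * - z" using z by simp
  finally have "inverse x = inverse y + of_nat p ^ k * (- z * inverse x * inverse y)" by simp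
  then show ?thesis
    using assms(4,5) z(1) by (intro pcongI[of _ "- z * inverse x * inverse y"]) (auto intro: p_integral_intros)
qed

lemma pcong_power_mono:
  assumes "pcong p k x y" "l \<le> k"
  shows "pcong p l x y"
proof -
  obtain z where z: "p_integral p y" "p_integral p z" "x = y + of_nat p ^ k * z"
    using assms(1) by (elim pcongE)
  have "x = y + of_nat p ^ l * (of_nat p ^ (k - l) * z)"
    using z assms(2) by (simp add: mult.assoc[symmetric] power_add[symmetric])
  then show ?thesis using z
    by (intro pcongI[of _ "of_nat p ^ (k - l) * z"] p_integral_intros) simp_all
qed

text \<open>The p-integral rationals have residue ring Z/p^k modulo p^k. This makes the description
  in \<open>wolst\<close> well defined.\<close>

lemma ex1_int_pcong:
  assumes "p_integral p x"
  shows "\<exists>!w. 0 \<le> w \<and> w < int p ^ k \<and> pcong p k (of_int w) x"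
proof -
  obtain a b where ab: "\<not> int p dvd b" "x = of_int a / of_int b"
    using assms unfolding p_integral_iff by blast
  then have b: "b \<noteq> 0" by auto
  have "coprime b (int p ^ k)"
    using prime_imp_coprime[OF prime_int_p ab(1)] by (simp add: coprime_commute)
  then obtain c where c: "[b * c = 1] (mod int p ^ k)" using cong_solve_coprime_int by blast
  \<comment> \<open>Here \<open>c\<close> inverts the denominator \<open>b\<close> modulo p^k, so
    \<open>w\<close> represents \<open>a / b\<close>.\<close>
  define w where "w = (a * c) mod int p ^ k"
  have pp: "int p ^ k > 0" using prime_gt_0_int[OF prime_int_p] by simp
  have "[b * w = b * (a * c)] (mod int p ^ k)"
    unfolding w_def by (intro cong_mult cong_refl) simp
  moreover have "[a * (b * c) = a * 1] (mod int p ^ k)" using c by (intro cong_mult cong_refl)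
  ultimately have "[b * w = a] (mod int p ^ k)"
    by (metis cong_trans mult.left_commute mult.right_neutral)
  then obtain q where q: "b * w - a = int p ^ k * q" by (auto simp: cong_iff_dvd_diff dvd_def)
  have "of_int w - x = of_int (b * w - a) / of_int b" using ab b by (simp add: field_simps)
  also have "\<dots> = of_nat p ^ k * (of_int q / of_int b)" unfolding q by simp
  finally have "pcong p k (of_int w) x"
    using assms ab(1)
    by (intro pcongI[of _ "of_int q / of_int b"]) (auto simp: p_integral_iff[of p "of_int q / of_int b"] algebra_simps)
  moreover have "0 \<le> w" "w < int p ^ k" using pp by (simp_all add: w_def)
  moreover have "v = u" if v: "0 \<le> v" "v < int p ^ k" "pcong p k (of_int v) x"
    and u: "0 \<le> u" "u < int p ^ k" "pcong p k (of_int u) x" for u v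
  proof -
    have "pcong p k (of_int v) (of_int u)" using u v pcong_sym pcong_trans by blast
    then obtain a b where ab: "\<not> int p dvd b"
      "(of_int v - of_int u :: rat) = of_nat p ^ k * (of_int a / of_int b)"
      unfolding pcong_def p_integral_iff by blast
    then have "b \<noteq> 0" by auto
    then have "(of_int ((v - u) * b) :: rat) = of_int (int p ^ k * a)"
      using ab by (simp add: field_simps)
    then have "(v - u) * b = int p ^ k * a" by (simp only: of_int_eq_iff)
    moreover have "coprime (int p ^ k) b"
      using ab(1) prime_int_p by (simp add: prime_imp_coprime)
    ultimately have "int p ^ k dvd v - u" by (metis coprime_dvd_mult_left_iff dvd_triv_left)
    then have "[v = u] (mod int p ^ k)" by (simp add: cong_iff_dvd_diff)
    then show ?thesis using u v by (simp add: cong_def)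
  qed
  ultimately show ?thesis by blast
qed

section \<open>Inverse power sums and expansion of products\<close>

text \<open>Leaving the multiplier \<open>a\<close> free allows \<open>a = 2\<close> for the
  exponents 2 and 4, where \<open>a ^ s - 1\<close> is 3 and 15.\<close>

lemma sum_inverse_power_pcong_0:
  assumes "\<not> p dvd a" "\<not> int p dvd int a ^ s - 1"
  shows "pcong p 1 (\<Sum>k=1..p-1. inverse (of_nat k) ^ s) 0"
proof -
  have cop: "coprime a p" using prime_imp_coprime[OF p assms(1)] by (simp add: coprime_commute)
  have p0: "p > 0" using p prime_gt_0_nat by simp
  have mem: "a * k mod p \<in> {1..p-1}" if "k \<in> {1..p-1}" for k
  proof -
    have "\<not> p dvd k" using that nat_dvd_not_less[of k p] p0 by (cases "k < p") auto
    then have "\<not> p dvd a * k" using p assms(1) by (simp add: prime_dvd_mult_iff)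
    then have "a * k mod p \<noteq> 0" by (simp add: mod_eq_0_iff_dvd)
    moreover have "a * k mod p < p" using p0 by simp
    ultimately show ?thesis by auto
  qed
  have inj: "inj_on (\<lambda>k. a * k mod p) {1..p-1}"
  proof (rule inj_onI)
    fix k l assume kl: "k \<in> {1..p-1}" "l \<in> {1..p-1}" "a * k mod p = a * l mod p"
    then have "[a * k = a * l] (mod p)" by (simp add: cong_def)
    then have "[k = l] (mod p)" using cop by (simp add: cong_mult_lcancel_nat)
    then show "k = l" using kl p0 by (auto simp: cong_def)
  qed
  have bij: "bij_betw (\<lambda>k. a * k mod p) {1..p-1} {1..p-1}"
    unfolding bij_betw_def using inj mem by (intro conjI endo_inj_surj image_subsetI) auto
  txt \<open>Multiplication by \<open>a\<close> permutes the nonzero residues, so \<open>S \<equiv> a\<^sup>-\<^sup>s S\<close>.\<close>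
  define S :: rat where "S = (\<Sum>k=1..p-1. inverse (of_nat k) ^ s)"
  have a: "\<not> int p dvd int a" using assms(1) by simp
  then have a0: "a \<noteq> 0" by (intro notI) simp
  have ia: "p_integral p (inverse (of_nat a))" using p_integral_inverse_of_int[OF a] by simp
  have "pcong p 1 (inverse (of_nat (a * k mod p)) ^ s) (inverse (of_nat a) ^ s * inverse (of_nat k) ^ s)"
    if k: "k \<in> {1..p-1}" for k
  proof -
    have "a * k = a * k mod p + p * (a * k div p)" by simp
    then have "(of_nat (a * k) :: rat) = of_nat (a * k mod p) + of_nat p ^ 1 * of_nat (a * k div p)"
      by (metis of_nat_add of_nat_mult power_one_right)
    then have "pcong p 1 (of_nat (a * k)) (of_nat (a * k mod p))"
      by (intro pcongI[of _ "of_nat (a * k div p)"]) auto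
    then have c: "pcong p 1 (of_nat (a * k mod p)) (of_nat (a * k))" by (rule pcong_sym)
    have ik: "p_integral p (inverse (of_nat k))" "p_integral p (inverse (of_nat (a * k mod p)))"
      using k mem[OF k] p0 by (auto intro!: p_integral_inverse_of_nat)
    have "pcong p 1 (inverse (of_nat (a * k mod p))) (inverse (of_nat (a * k)))"
      using c ik ia mem[OF k] k a0
      by (intro pcong_inverse) (auto intro!: p_integral_mult simp: dvd_eq_mod_eq_0)
    from pcong_power[OF this, of s] show ?thesis by (simp add: power_mult_distrib)
  qed
  then have "pcong p 1 (\<Sum>k=1..p-1. inverse (of_nat (a * k mod p)) ^ s)
      (\<Sum>k=1..p-1. inverse (of_nat a) ^ s * inverse (of_nat k) ^ s)"
    by (rule pcong_sum)
  also have "(\<Sum>k=1..p-1. inverse (of_nat (a * k mod p)) ^ s) = S"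
    unfolding S_def by (rule sum.reindex_bij_betw[OF bij])
  also have "(\<Sum>k=1..p-1. inverse (of_nat a) ^ s * inverse (of_nat k) ^ s) = inverse (of_nat a) ^ s * S"
    unfolding S_def by (rule sum_distrib_left[symmetric])
  finally obtain z where z: "p_integral p z" "S = inverse (of_nat a) ^ s * S + of_nat p * z"
    by (elim pcongE) auto
  have "int a ^ s - 1 \<noteq> 0" using assms(2) by auto
  then have "(of_int (int a ^ s - 1) :: rat) \<noteq> 0" by (simp only: of_int_eq_0_iff not_False_eq_True)
  then have n: "(of_nat a ^ s - 1 :: rat) \<noteq> 0" by simp
  \<comment> \<open>Rearranged, this reads \<open>(a ^ s - 1) * S = p * a ^ s * z\<close>, and
    \<open>a ^ s - 1\<close> is a unit by hypothesis.\<close>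
  have "of_nat a ^ s * S = S + of_nat p * (of_nat a ^ s * z)"
    using z(2) a0 by (simp add: field_simps)
  then have "S = of_nat p * (of_nat a ^ s * z * inverse (of_nat a ^ s - 1))"
    using n by (simp add: field_simps)
  moreover have "p_integral p (inverse (of_nat a ^ s - 1))"
    using p_integral_inverse_of_int[OF assms(2)] by simp
  ultimately show ?thesis using z(1) unfolding S_def[symmetric]
    by (intro pcongI[of _ "of_nat a ^ s * z * inverse (of_nat a ^ s - 1)"] p_integral_intros) auto
qed

text \<open>Newton's identity expresses the second elementary symmetric sum by power sums, the
  quantities controlled modulo p. Since p is odd, halving preserves integrality.\<close>

lemma prod_one_plus_expand:
  assumes "2 < p" "finite A" "p_integral p y" "\<And>i. i \<in> A \<Longrightarrow> p_integral p (t i)"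
  shows "\<exists>z. p_integral p z \<and> (\<Prod>i\<in>A. 1 + y * t i) =
    1 + y * sum t A + y\<^sup>2 * (((sum t A)\<^sup>2 - (\<Sum>i\<in>A. (t i)\<^sup>2)) / 2) + y ^ 3 * z"
  using assms(2,4)
proof (induction A rule: finite_induct)
  case empty
  show ?case by (auto intro!: exI[of _ 0])
next
  case (insert i A)
  define E where "E = ((sum t A)\<^sup>2 - (\<Sum>i\<in>A. (t i)\<^sup>2)) / 2"
  obtain z where z: "p_integral p z" "(\<Prod>i\<in>A. 1 + y * t i) = 1 + y * sum t A + y\<^sup>2 * E + y ^ 3 * z"
    using insert unfolding E_def by auto
  have "p_integral p E"
    unfolding E_def using p_integral_divide_of_nat[of "(sum t A)\<^sup>2 - (\<Sum>i\<in>A. (t i)\<^sup>2)" 2]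
      assms(1) insert.prems by (simp add: p_integral_intros)
  then have "p_integral p (z + t i * E + y * t i * z)"
    using z assms(3) insert.prems by (auto intro!: p_integral_intros)
  moreover have "((sum t (insert i A))\<^sup>2 - (\<Sum>i\<in>insert i A. (t i)\<^sup>2)) / 2 = E + t i * sum t A"
    using insert.hyps unfolding E_def by (simp add: field_simps power2_eq_square)
  moreover have "(\<Prod>i\<in>insert i A. 1 + y * t i) =
      1 + y * sum t (insert i A) + y\<^sup>2 * (E + t i * sum t A) + y ^ 3 * (z + t i * E + y * t i * z)"
    using insert.hyps z(2) by (simp add: algebra_simps power2_eq_square power3_eq_cube)
  ultimately show ?case by auto
qed

section \<open>Numbers of the form 1 + a p^3 modulo p^5\<close>

text \<open>The coefficient \<open>a\<close> acts as a logarithm: cross terms carry p^6, so products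
  of such numbers become sums of coefficients.\<close>

definition cubic_cong :: "rat \<Rightarrow> rat \<Rightarrow> bool" where
  "cubic_cong u a \<longleftrightarrow> p_integral p a \<and> pcong p 5 u (1 + a * of_nat p ^ 3)"

lemma cubic_cong_pcong_1:
  assumes "cubic_cong u a"
  shows "pcong p 3 u 1"
proof -
  have a: "p_integral p a" "pcong p 5 u (1 + a * of_nat p ^ 3)"
    using assms unfolding cubic_cong_def by auto
  have "pcong p 3 (1 + a * of_nat p ^ 3) 1" using a(1) by (intro pcongI[of _ a]) auto
  then show ?thesis using pcong_power_mono[OF a(2), of 3] pcong_trans by auto
qed

lemma cubic_cong_1: "cubic_cong 1 0"
  unfolding cubic_cong_def by (simp add: pcong_refl)

text \<open>A change of \<open>a\<close> by p^2 is invisible modulo p^5; hence knowing the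
  Wolstenholme quotient modulo p^2 is enough.\<close>

lemma cubic_cong_coeff:
  assumes "cubic_cong u a" "pcong p 2 a b"
  shows "cubic_cong u b"
proof -
  obtain z where z: "p_integral p z" "p_integral p b" "a = b + of_nat p ^ 2 * z"
    using assms(2) by (elim pcongE)
  have "pcong p 5 (1 + a * of_nat p ^ 3) (1 + b * of_nat p ^ 3)"
    using z by (intro pcongI[of _ z] p_integral_intros)
      (simp_all add: algebra_simps power_add[symmetric] flip: mult.assoc)
  then show ?thesis using assms(1) z pcong_trans unfolding cubic_cong_def by blast
qed

lemma cubic_cong_mult:
  assumes "cubic_cong u a" "cubic_cong v b"
  shows "cubic_cong (u * v) (a + b)"
proof -
  have ab: "p_integral p a" "p_integral p b" using assms unfolding cubic_cong_def by auto
  have "pcong p 5 (u * v) ((1 + a * of_nat p ^ 3) * (1 + b * of_nat p ^ 3))"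
    using assms unfolding cubic_cong_def by (blast intro: pcong_mult)
  also have "pcong p 5 \<dots> (1 + (a + b) * of_nat p ^ 3)"
    using ab by (intro pcongI[of _ "a * b * of_nat p"] p_integral_intros)
      (simp_all add: algebra_simps eval_nat_numeral)
  finally show ?thesis using ab unfolding cubic_cong_def by (simp add: p_integral_add)
qed

text \<open>Both \<open>u\<close> and \<open>1 + a p^3\<close> are 1 modulo p, hence units, and
  \<open>(1 - a p^3) (1 + a p^3)\<close> differs from 1 by \<open>a^2 p^6\<close>.\<close>

lemma cubic_cong_inverse:
  assumes "cubic_cong u a"
  shows "cubic_cong (inverse u) (- a)"
proof -
  have a: "p_integral p a" "pcong p 5 u (1 + a * of_nat p ^ 3)"
    using assms unfolding cubic_cong_def by auto
  obtain z where z: "p_integral p z" "u = 1 + a * of_nat p ^ 3 + of_nat p ^ 5 * z"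
    using a(2) by (elim pcongE)
  have n1: "\<not> int p dvd 1" using prime_int_p by (auto simp: not_prime_unit)
  have e: "1 + a * of_nat p ^ 3 = of_int 1 + of_nat p * (a * of_nat p ^ 2)"
    "u = of_int 1 + of_nat p * (a * of_nat p ^ 2 + of_nat p ^ 4 * z)"
    using z(2) by (simp_all add: algebra_simps eval_nat_numeral)
  have u1: "1 + a * of_nat p ^ 3 \<noteq> 0" "p_integral p (inverse (1 + a * of_nat p ^ 3))"
    using unit_of_int_plus[OF n1, of "a * of_nat p ^ 2"] a(1) unfolding e
    by (simp_all add: p_integral_intros)
  have u2: "u \<noteq> 0" "p_integral p (inverse u)"
    using unit_of_int_plus[OF n1, of "a * of_nat p ^ 2 + of_nat p ^ 4 * z"] a(1) z(1) unfolding e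
    by (simp_all add: p_integral_intros)
  have "pcong p 5 (inverse u) (inverse (1 + a * of_nat p ^ 3))"
    using a(2) u1 u2 by (intro pcong_inverse)
  also have "pcong p 5 \<dots> (1 + - a * of_nat p ^ 3)"
  proof (rule pcongI)
    show "p_integral p (of_nat p * a\<^sup>2 * inverse (1 + a * of_nat p ^ 3))"
      using a u1 by (intro p_integral_intros) auto
    show "p_integral p (1 + - a * of_nat p ^ 3)"
      using a by (intro p_integral_intros) auto
    have "(1 + - a * of_nat p ^ 3) * (1 + a * of_nat p ^ 3) + of_nat p ^ 5 * (of_nat p * a\<^sup>2) = 1"
      by (simp add: algebra_simps eval_nat_numeral)
    then show "inverse (1 + a * of_nat p ^ 3) = 1 + - a * of_nat p ^ 3 +
        of_nat p ^ 5 * (of_nat p * a\<^sup>2 * inverse (1 + a * of_nat p ^ 3))"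
      using u1(1) by (simp add: divide_simps)
  qed
  finally show ?thesis using a unfolding cubic_cong_def by (simp add: p_integral_minus)
qed

lemma cubic_cong_prod:
  "(\<And>i. i \<in> A \<Longrightarrow> cubic_cong (u i) (a i)) \<Longrightarrow> cubic_cong (prod u A) (sum a A)"
  by (induction A rule: infinite_finite_induct) (auto intro: cubic_cong_1 cubic_cong_mult)

text \<open>The factor at \<open>k\<close> has coefficient \<open>x / k\<close>, integral because
  \<open>k < p\<close>; adding these up produces the harmonic number.\<close>

lemma cubic_cong_shifted_prod:
  assumes "p_integral p x" "n < p"
  shows "cubic_cong (shifted_prod (x * of_nat p ^ 3) n) (x * H1 n)"
proof -
  have "cubic_cong (1 + x * of_nat p ^ 3 / of_nat k) (x / of_nat k)" if "k \<in> {1..n}" for k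
  proof -
    have "p_integral p (x / of_nat k)"
      using that assms by (intro p_integral_divide_of_nat) auto
    then have "pcong p 5 (1 + x / of_nat k * of_nat p ^ 3) (1 + x / of_nat k * of_nat p ^ 3)"
      by (intro pcong_refl p_integral_intros) auto
    then show ?thesis using \<open>p_integral p (x / of_nat k)\<close> unfolding cubic_cong_def by simp
  qed
  from cubic_cong_prod[of "{1..n}", OF this] show ?thesis
    unfolding shifted_prod_def H1_def by (simp add: sum_distrib_left)
qed

section \<open>Wolstenholme's theorem and one block of length p\<close>

text \<open>Pairing gives \<open>1 / k + 1 / (p - k) = p / (k (p - k))\<close>, one factor p of
  Wolstenholme's theorem. The second comes from the sum on the left vanishing modulo p.\<close>

lemma sum_inverse_reflect:
  "of_nat p * (\<Sum>k=1..p-1. inverse (of_nat k) * inverse (of_nat (p - k))) = 2 * H1 (p - 1)"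
proof -
  have "of_nat p * (inverse (of_nat k) * inverse (of_nat (p - k))) =
      inverse (of_nat k) + inverse (of_nat (p - k) :: rat)" if "k \<in> {1..p-1}" for k
    using that by (auto simp: field_simps of_nat_diff)
  then have "of_nat p * (\<Sum>k=1..p-1. inverse (of_nat k) * inverse (of_nat (p - k))) =
      (\<Sum>k=1..p-1. inverse (of_nat k) + inverse (of_nat (p - k) :: rat))"
    unfolding sum_distrib_left by (rule sum.cong[OF refl])
  moreover have "(\<Sum>k=1..p-1. inverse (of_nat (p - k) :: rat)) = (\<Sum>k=1..p-1. inverse (of_nat k))"
    by (rule sum.reindex_bij_witness[of _ "\<lambda>k. p - k" "\<lambda>k. p - k"]) auto
  ultimately show ?thesis by (simp add: sum.distrib H1_def inverse_eq_divide)
qed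

text \<open>In a pair the linear part \<open>j p (1 / k + 1 / (p - k))\<close> is
  \<open>j p^2 / (k (p - k))\<close> and merges with the quadratic part
  \<open>j^2 p^2 / (k (p - k))\<close>.\<close>

lemma shifted_prod_square:
  "(shifted_prod (of_nat (j * p)) (p - 1))\<^sup>2 =
    (\<Prod>k=1..p-1. 1 + of_nat (j * (j + 1)) * of_nat p ^ 2 * (inverse (of_nat k) * inverse (of_nat (p - k))))"
proof -
  have "(\<Prod>k=1..p-1. 1 + of_nat (j * p) / of_nat k :: rat) = (\<Prod>k=1..p-1. 1 + of_nat (j * p) / of_nat (p - k))"
    by (rule prod.reindex_bij_witness[of _ "\<lambda>k. p - k" "\<lambda>k. p - k"]) auto
  then have "(shifted_prod (of_nat (j * p)) (p - 1))\<^sup>2 =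
      (\<Prod>k=1..p-1. (1 + of_nat (j * p) / of_nat k) * (1 + of_nat (j * p) / of_nat (p - k)))"
    unfolding shifted_prod_def power2_eq_square prod.distrib by simp
  also have "\<dots> = (\<Prod>k=1..p-1. 1 + of_nat (j * (j + 1)) * of_nat p ^ 2 * (inverse (of_nat k) * inverse (of_nat (p - k))))"
    by (rule prod.cong) (auto simp: field_simps of_nat_diff power2_eq_square)
  finally show ?thesis .
qed

text \<open>Since \<open>p - k\<close> is \<open>- k\<close> modulo p, the summands reduce to
  \<open>- 1 / k^2\<close> and \<open>1 / k^4\<close>.\<close>

lemma reflected_sums_pcong_0:
  assumes "p \<ge> 7"
  shows "pcong p 1 (\<Sum>k=1..p-1. inverse (of_nat k) * inverse (of_nat (p - k))) 0"
    and "pcong p 1 (\<Sum>k=1..p-1. (inverse (of_nat k) * inverse (of_nat (p - k)))\<^sup>2) 0"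
proof -
  have nd: "\<not> p dvd 2" using assms by (auto dest: dvd_imp_le)
  have "\<not> int p dvd 3" using assms by (auto dest: zdvd_imp_le)
  then have s2: "pcong p 1 (\<Sum>k=1..p-1. inverse (of_nat k) ^ 2) 0"
    using sum_inverse_power_pcong_0[OF nd, of 2] by simp
  \<comment> \<open>The value \<open>2 ^ 4 - 1 = 15\<close> must be prime to p, which holds since
    \<open>p >= 7\<close>.\<close>
  have "\<not> int p dvd 3 * 5"
    using assms prime_int_p by (subst prime_dvd_mult_iff) (auto dest: zdvd_imp_le)
  then have s4: "pcong p 1 (\<Sum>k=1..p-1. inverse (of_nat k) ^ 4) 0"
    using sum_inverse_power_pcong_0[OF nd, of 4] by simp
  have c: "pcong p 1 (inverse (of_nat k) * inverse (of_nat (p - k))) (- 1 * inverse (of_nat k) ^ 2)"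
    if k: "k \<in> {1..p-1}" for k
  proof (rule pcongI)
    have i: "p_integral p (inverse (of_nat k))" "p_integral p (inverse (of_nat (p - k)))"
      using k by (auto intro!: p_integral_inverse_of_nat)
    then show "p_integral p (inverse (of_nat k) ^ 2 * inverse (of_nat (p - k)))"
      "p_integral p (- 1 * inverse (of_nat k) ^ 2)"
      by (auto intro!: p_integral_intros)
    show "inverse (of_nat k) * inverse (of_nat (p - k)) = - 1 * inverse (of_nat k) ^ 2 +
        of_nat p ^ 1 * (inverse (of_nat k) ^ 2 * inverse (of_nat (p - k) :: rat))"
      using k by (auto simp: field_simps of_nat_diff power2_eq_square)
  qed
  have m1: "pcong p 1 (- 1) (- 1)" using p_integral_minus[OF p_integral_1] by (rule pcong_refl)
  have "pcong p 1 (\<Sum>k=1..p-1. inverse (of_nat k) * inverse (of_nat (p - k)))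
      (- 1 * (\<Sum>k=1..p-1. inverse (of_nat k) ^ 2))"
    unfolding sum_distrib_left by (rule pcong_sum) (rule c)
  also have "pcong p 1 \<dots> (- 1 * 0)" by (rule pcong_mult[OF m1 s2])
  finally show "pcong p 1 (\<Sum>k=1..p-1. inverse (of_nat k) * inverse (of_nat (p - k))) 0" by simp
  have "pcong p 1 (\<Sum>k=1..p-1. (inverse (of_nat k) * inverse (of_nat (p - k)))\<^sup>2)
      (\<Sum>k=1..p-1. (- 1 * inverse (of_nat k) ^ 2)\<^sup>2)"
    by (rule pcong_sum) (rule pcong_power[OF c])
  also have "(\<Sum>k=1..p-1. (- 1 * inverse (of_nat k :: rat) ^ 2)\<^sup>2) = (\<Sum>k=1..p-1. inverse (of_nat k) ^ 4)"
    by (simp flip: power_mult)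
  also note s4
  finally show "pcong p 1 (\<Sum>k=1..p-1. (inverse (of_nat k) * inverse (of_nat (p - k)))\<^sup>2) 0" .
qed

text \<open>The integrality assumed here is Wolstenholme's theorem; it is discharged inside
  \<open>cubic_cong_block\<close>.\<close>

lemma pcong_wolst:
  assumes "p_integral p (H1 (p - 1) / of_nat p ^ 2)"
  shows "pcong p 2 (of_int (wolst p)) (H1 (p - 1) / of_nat p ^ 2)"
  using theI'[OF ex1_int_pcong[OF assms, of 2]] unfolding wolst_def by blast

lemma cubic_cong_block:
  assumes p7: "p \<ge> 7"
  shows "cubic_cong (shifted_prod (of_nat (j * p)) (p - 1)) (of_int (wolst p) * of_nat (j * (j + 1)))"
proof -
  define t :: "nat \<Rightarrow> rat" where "t k = inverse (of_nat k) * inverse (of_nat (p - k))" for k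
  define S where "S = (\<Sum>k=1..p-1. t k)"
  define Q where "Q = (\<Sum>k=1..p-1. (t k)\<^sup>2)"
  define G where "G = shifted_prod (of_nat (j * p)) (p - 1)"
  define c :: rat where "c = of_nat (j * (j + 1))"
  define P :: rat where "P = of_nat p"
  have P: "p_integral p P" "P \<noteq> 0" using prime_gt_0_nat[OF p] by (simp_all add: P_def)
  have c: "p_integral p c" unfolding c_def by (rule p_integral_of_nat)
  have "pcong p 1 S 0" "pcong p 1 Q 0"
    using reflected_sums_pcong_0[OF p7] unfolding S_def Q_def t_def .
  then obtain z q where z: "p_integral p z" "S = P * z" and q: "p_integral p q" "Q = P * q"
    unfolding P_def by (elim pcongE) auto
  \<comment> \<open>From \<open>S = P * z\<close> and \<open>P * S = 2 * H1 (p - 1)\<close>, this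
    \<open>h\<close> is exactly the quotient of \<open>H1 (p - 1)\<close> by p^2.\<close>
  define h where "h = z / 2"
  have h: "p_integral p h" using p_integral_divide_of_nat[OF z(1), of 2] p7 by (simp add: h_def)
  have "H1 (p - 1) / of_nat p ^ 2 = h"
    using sum_inverse_reflect z P unfolding S_def t_def h_def P_def
    by (simp add: field_simps power2_eq_square)
  then have w: "pcong p 2 h (of_int (wolst p))" using pcong_wolst h pcong_sym by simp
  have "p_integral p (t k)" if "k \<in> {1..p-1}" for k
    unfolding t_def using that by (auto intro!: p_integral_mult p_integral_inverse_of_nat)
  then obtain y where y: "p_integral p y"
      "(\<Prod>k=1..p-1. 1 + c * P ^ 2 * t k) = 1 + c * P ^ 2 * S + (c * P ^ 2)\<^sup>2 * ((S\<^sup>2 - Q) / 2) + (c * P ^ 2) ^ 3 * y"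
    using prod_one_plus_expand[of "{1..p-1}" "c * P ^ 2" t] p7 c P unfolding S_def Q_def
    by (auto simp: p_integral_intros)
  have G2: "G\<^sup>2 = (\<Prod>k=1..p-1. 1 + c * P ^ 2 * t k)"
    unfolding G_def c_def P_def t_def by (rule shifted_prod_square)
  \<comment> \<open>\<open>A\<close> is the expected value of \<open>G\<close>, and \<open>e\<close>
    is the quotient of \<open>G^2 - A^2\<close> by p^5: the quadratic and cubic terms of the
    expansion minus the square term of \<open>A^2\<close>. The linear term \<open>c P^2 S\<close>
    equals \<open>2 c h P^3\<close> and cancels.\<close>
  define A where "A = 1 + c * h * P ^ 3"
  define e where "e = c\<^sup>2 * ((P * z\<^sup>2 - q) / 2) + c ^ 3 * P * y - c\<^sup>2 * h\<^sup>2 * P"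
  have "p_integral p e"
    unfolding e_def using p_integral_divide_of_nat[of "P * z\<^sup>2 - q" 2] p7 c P z(1) q(1) y(1) h
    by (intro p_integral_intros) (simp_all add: p_integral_intros)
  have G2A: "G\<^sup>2 = A\<^sup>2 + P ^ 5 * e"
    unfolding G2 y(2) A_def e_def z(2) q(2) h_def by (simp add: field_simps eval_nat_numeral)
  have "pcong p 1 (1 + of_nat (j * p) / of_nat k) 1" if "k \<in> {1..p-1}" for k
    using that by (intro pcongI[of _ "of_nat j / of_nat k"] p_integral_divide_of_nat) auto
  then have "pcong p 1 G (\<Prod>k=1..p-1. 1)" unfolding G_def shifted_prod_def by (rule pcong_prod)
  then obtain g where g: "p_integral p g" "G = 1 + P * g" unfolding P_def by (elim pcongE) auto
  have GA: "G + A = of_int 2 + of_nat p * (g + c * h * P ^ 2)"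
    unfolding g(2) A_def P_def by (simp add: algebra_simps eval_nat_numeral)
  have "\<not> int p dvd 2" using p7 by (auto dest: zdvd_imp_le)
  then have u: "G + A \<noteq> 0" "p_integral p (inverse (G + A))"
    using unit_of_int_plus[of 2 "g + c * h * P ^ 2"] g c h P unfolding GA
    by (simp_all add: p_integral_intros)
  txt \<open>The congruence for \<open>G\<^sup>2\<close> passes to \<open>G\<close> because \<open>G + A \<equiv> 2\<close> is a unit modulo \<open>p\<close>.\<close>
  have "(G - A) * (G + A) = P ^ 5 * e" using G2A by (simp add: algebra_simps power2_eq_square)
  then have "G = A + P ^ 5 * (e * inverse (G + A))" using u(1) by (simp add: field_simps)
  then have "pcong p 5 G A"
    using \<open>p_integral p e\<close> u c h P unfolding P_def
    by (intro pcongI[of _ "e * inverse (G + A)"]) (auto simp: A_def P_def intro!: p_integral_intros)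
  then have "cubic_cong G (c * h)"
    using c h unfolding cubic_cong_def A_def P_def by (simp add: p_integral_intros)
  moreover have "pcong p 2 (c * h) (c * of_int (wolst p))"
    using c w by (intro pcong_mult pcong_refl)
  ultimately show ?thesis
    using cubic_cong_coeff unfolding G_def c_def by (simp add: mult.commute)
qed

section \<open>Binomial coefficients of multiples of p and of p^3\<close>

text \<open>The multiples of p contribute \<open>p ^ N * fact N\<close>; the numbers strictly
  between \<open>j p\<close> and \<open>(j + 1) p\<close> contribute \<open>fact (p - 1)\<close>
  times a shifted product.\<close>

lemma fact_mult_p:
  "(fact (N * p) :: rat) =
    of_nat p ^ N * fact N * fact (p - 1) ^ N * (\<Prod>j<N. shifted_prod (of_nat (j * p)) (p - 1))"
proof (induction N)
  case (Suc N)
  have "Suc N * p = Suc (N * p + (p - 1))" using prime_gt_0_nat[OF p] by simp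
  then have "(fact (Suc N * p) :: rat) = of_nat (Suc N * p) * fact (N * p + (p - 1))"
    by (metis fact_Suc)
  also have "\<dots> = of_nat (Suc N) * of_nat p *
      (fact (N * p) * fact (p - 1) * shifted_prod (of_nat (N * p)) (p - 1))"
    unfolding fact_add_shifted_prod by (simp add: algebra_simps)
  finally show ?case unfolding Suc.IH by (simp add: algebra_simps)
qed simp

lemma cubic_cong_binomial_mult_p:
  assumes "p \<ge> 7" "R \<le> N"
  shows "cubic_cong (of_nat ((N * p) choose (R * p)) / of_nat (N choose R))
    (of_int (wolst p) * of_nat N * of_nat R * (of_nat N - of_nat R))"
proof -
  define B where "B N = (\<Prod>j<N. shifted_prod (of_nat (j * p)) (p - 1))" for N
  define D where "D = N - R"
  have N: "N = R + D" using assms(2) by (simp add: D_def)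
  have sum: "(\<Sum>j<N. of_int (wolst p) * of_nat (j * (j + 1))) =
      of_int (wolst p) * ((of_nat N ^ 3 - of_nat N) / 3 :: rat)" for N
    by (induction N) (simp_all add: field_simps power3_eq_cube)
  have B: "cubic_cong (B N) (of_int (wolst p) * ((of_nat N ^ 3 - of_nat N) / 3))" for N
    unfolding B_def sum[symmetric] by (intro cubic_cong_prod cubic_cong_block assms)
  have nz: "B k \<noteq> 0" for k
    using fact_mult_p[of k] unfolding B_def by (metis fact_nonzero mult_zero_right)
  have "cubic_cong (B N * inverse (B R) * inverse (B D))
    (of_int (wolst p) * ((of_nat N ^ 3 - of_nat N) / 3) + - (of_int (wolst p) * ((of_nat R ^ 3 - of_nat R) / 3))
      + - (of_int (wolst p) * ((of_nat D ^ 3 - of_nat D) / 3)))"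
    by (intro cubic_cong_mult cubic_cong_inverse B)
  moreover have "B N * inverse (B R) * inverse (B D) = of_nat ((N * p) choose (R * p)) / of_nat (N choose R)"
  proof -
    have "N * p - R * p = D * p" by (simp add: D_def diff_mult_distrib)
    then have C: "(of_nat ((N * p) choose (R * p)) :: rat) = fact (N * p) / (fact (R * p) * fact (D * p))"
      using assms(2) by (simp add: binomial_fact)
    have C': "(of_nat (N choose R) :: rat) = fact N / (fact R * fact D)"
      using assms(2) by (simp add: binomial_fact D_def)
    \<comment> \<open>Because \<open>N = R + D\<close>, the powers of p and of
      \<open>fact (p - 1)\<close> cancel.\<close>
    show ?thesis
      using nz prime_gt_0_nat[OF p] unfolding C C' fact_mult_p B_def[symmetric]
      by (simp add: N power_add field_simps)
  qed
  \<comment> \<open>The linear terms cancel, and \<open>N^3 - R^3 - D^3 = 3 N R D\<close>.\<close>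
  moreover have "of_int (wolst p) * ((of_nat N ^ 3 - of_nat N) / 3) + - (of_int (wolst p) * ((of_nat R ^ 3 - of_nat R) / 3))
      + - (of_int (wolst p) * ((of_nat D ^ 3 - of_nat D) / 3)) =
    of_int (wolst p) * of_nat N * of_nat R * (of_nat N - of_nat R :: rat)"
    by (simp add: N field_simps power3_eq_cube)
  ultimately show ?thesis by simp
qed

text \<open>Telescopes through the exponents 0 to 3. Scaling \<open>N\<close> and \<open>R\<close>
  by \<open>p ^ i\<close> scales the cubic coefficient by \<open>p ^ (3 * i)\<close>, so only the
  first step has a coefficient that may be nonzero modulo p^2.\<close>

lemma cubic_cong_binomial_mult_p_cubed:
  assumes "p \<ge> 7" "R \<le> N"
  shows "cubic_cong (of_nat ((N * p ^ 3) choose (R * p ^ 3)) / of_nat (N choose R))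
    (of_int (wolst p) * of_nat N * of_nat R * (of_nat N - of_nat R))"
proof -
  define T :: "nat \<Rightarrow> rat" where "T i = of_nat ((N * p ^ i) choose (R * p ^ i))" for i
  define a :: rat where "a = of_int (wolst p) * of_nat N * of_nat R * (of_nat N - of_nat R)"
  have a: "p_integral p a" unfolding a_def by (auto intro!: p_integral_intros)
  have T: "T i \<noteq> 0" for i using assms(2) by (simp add: T_def)
  have step: "cubic_cong (T (Suc i) / T i) (a * of_nat p ^ (3 * i))" for i
  proof -
    have "cubic_cong (T (Suc i) / T i) (of_int (wolst p) * of_nat (N * p ^ i) * of_nat (R * p ^ i) *
        (of_nat (N * p ^ i) - of_nat (R * p ^ i)))"
      using cubic_cong_binomial_mult_p[of "R * p ^ i" "N * p ^ i"] assms
      by (simp add: T_def mult.assoc mult.commute[of p])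
    then show ?thesis by (simp add: a_def algebra_simps power_mult power3_eq_cube)
  qed
  have zero: "cubic_cong (T (Suc i) / T i) 0" if "i > 0" for i
  proof (rule cubic_cong_coeff[OF step])
    have "3 * i = 2 + (3 * i - 2)" using that by simp
    then have "(of_nat p :: rat) ^ (3 * i) = of_nat p ^ 2 * of_nat p ^ (3 * i - 2)" by (metis power_add)
    then show "pcong p 2 (a * of_nat p ^ (3 * i)) 0"
      using a by (intro pcongI[of _ "a * of_nat p ^ (3 * i - 2)"] p_integral_intros) auto
  qed
  have "cubic_cong (T 1 / T 0 * (T 2 / T 1) * (T 3 / T 2)) (a + 0 + 0)"
    using step[of 0] zero[of 1] zero[of 2]
    by (intro cubic_cong_mult) (simp_all add: eval_nat_numeral)
  moreover have "T 1 / T 0 * (T 2 / T 1) * (T 3 / T 2) = T 3 / T 0" using T[of 1] T[of 2] by simp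
  ultimately show ?thesis by (simp add: T_def a_def)
qed

section \<open>The offsets n and r, without and with a borrow\<close>

text \<open>Without a borrow the lower difference is \<open>D p^3 + (n - r)\<close>, so each of the
  three factorials splits off one shifted product; their coefficients \<open>N H1 n\<close>,
  \<open>- R H1 r\<close> and \<open>- D H1 (n - r)\<close> add to that of the multiples of
  p^3.\<close>

lemma binomial_pcong_le:
  assumes "p \<ge> 7" "R \<le> N" "n < p" "r \<le> n"
  shows "pcong p 5
    (of_nat ((N * p ^ 3 + n) choose (R * p ^ 3 + r)) / (of_nat (N choose R) * of_nat (n choose r)))
    (1 + c_coeff N R n r p * of_nat p ^ 3)"
proof -
  define D where "D = N - R"
  have N: "N = R + D" using assms(2) by (simp add: D_def)
  define W where "W X m = shifted_prod (of_nat X * of_nat p ^ 3) m" for X m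
  define T :: rat where "T = of_nat ((N * p ^ 3) choose (R * p ^ 3))"
  have W: "cubic_cong (W X m) (of_nat X * H1 m)" if "m < p" for X m
    unfolding W_def using that by (intro cubic_cong_shifted_prod) auto
  have F: "(fact (X * p ^ 3 + m) :: rat) = fact (X * p ^ 3) * fact m * W X m" for X m
    using fact_add_shifted_prod[of "X * p ^ 3" m] by (simp add: W_def)
  have nz: "W X m \<noteq> 0" for X m using F[of X m] by (metis fact_nonzero mult_zero_right)
  have "cubic_cong (T / of_nat (N choose R) * W N n * inverse (W R r) * inverse (W D (n - r)))
    (of_int (wolst p) * of_nat N * of_nat R * (of_nat N - of_nat R) + of_nat N * H1 n
      + - (of_nat R * H1 r) + - (of_nat D * H1 (n - r)))"
    unfolding T_def using assms
    by (intro cubic_cong_mult cubic_cong_inverse W cubic_cong_binomial_mult_p_cubed) auto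
  moreover have "of_int (wolst p) * of_nat N * of_nat R * (of_nat N - of_nat R) + of_nat N * H1 n
      + - (of_nat R * H1 r) + - (of_nat D * H1 (n - r)) = c_coeff N R n r p"
    unfolding c_coeff_def by (simp add: N algebra_simps)
  moreover have "T / of_nat (N choose R) * W N n * inverse (W R r) * inverse (W D (n - r)) =
    of_nat ((N * p ^ 3 + n) choose (R * p ^ 3 + r)) / (of_nat (N choose R) * of_nat (n choose r))"
  proof -
    have "N * p ^ 3 - R * p ^ 3 = D * p ^ 3" by (simp add: D_def diff_mult_distrib)
    then have T: "T = fact (N * p ^ 3) / (fact (R * p ^ 3) * fact (D * p ^ 3))"
      using assms(2) by (simp add: T_def binomial_fact)
    have "N * p ^ 3 + n - (R * p ^ 3 + r) = D * p ^ 3 + (n - r)"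
      using assms(4) by (simp add: N algebra_simps)
    moreover have "R * p ^ 3 + r \<le> N * p ^ 3 + n" using assms by (simp add: add_mono)
    ultimately have C: "(of_nat ((N * p ^ 3 + n) choose (R * p ^ 3 + r)) :: rat) =
        fact (N * p ^ 3) * fact n * W N n /
        (fact (R * p ^ 3) * fact r * W R r * (fact (D * p ^ 3) * fact (n - r) * W D (n - r)))"
      by (simp only: binomial_fact F)
    have C': "(of_nat (n choose r) :: rat) = fact n / (fact r * fact (n - r))"
      using assms(4) by (simp add: binomial_fact)
    show ?thesis unfolding C C' T using nz by (simp add: field_simps)
  qed
  ultimately show ?thesis unfolding cubic_cong_def by simp
qed

text \<open>With a borrow the lower factorial stops below \<open>D p^3\<close>, so the factor
  \<open>D p^3\<close> stays in the quotient. All remaining correction factors need only be known to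
  be 1 modulo p^3.\<close>

lemma binomial_pcong_gt:
  assumes "p \<ge> 7" "R \<le> N" "r < p" "n < r"
  shows "pcong p 5
    (of_nat ((N * p ^ 3 + n) choose (R * p ^ 3 + r)) / of_nat (N choose R))
    ((-1) ^ (r - n + 1) * ((of_nat N - of_nat R) / of_nat r)
      * inverse (of_nat ((r - 1) choose n)) * of_nat p ^ 3)"
proof (cases "N = R")
  case True
  then show ?thesis using assms by (simp add: binomial_eq_0 pcong_refl)
next
  case False
  define D where "D = N - R"
  have N: "N = R + D" and D: "D > 0" using assms(2) False by (simp_all add: D_def)
  \<comment> \<open>Beyond \<open>D p^3\<close> itself, \<open>d\<close> further factors are
    removed; also \<open>d = (r - 1) - n\<close>, the complementary index in the binomial
    coefficient.\<close>
  define d where "d = r - n - 1"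
  have d: "r = n + Suc d" using assms(4) by (simp add: d_def)
  \<comment> \<open>This bound keeps the natural subtraction \<open>D p^3 - (d + 1)\<close> from
    truncating.\<close>
  have "p \<le> p ^ 3" using prime_gt_0_nat[OF p] by (simp add: self_le_power)
  also have "\<dots> \<le> D * p ^ 3" using D by simp
  finally have pD: "p \<le> D * p ^ 3" .
  define W where "W X m = shifted_prod (X * of_nat p ^ 3) m" for X m
  define T :: rat where "T = of_nat ((N * p ^ 3) choose (R * p ^ 3))"
  have W: "cubic_cong (W X m) (X * H1 m)" if "m < p" "p_integral p X" for X m
    unfolding W_def using that by (intro cubic_cong_shifted_prod) auto
  have F: "(fact (X * p ^ 3 + m) :: rat) = fact (X * p ^ 3) * fact m * W (of_nat X) m" for X m
    using fact_add_shifted_prod[of "X * p ^ 3" m] by (simp add: W_def)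
  have nz: "W (of_nat X) m \<noteq> 0" for X m using F[of X m] by (metis fact_nonzero mult_zero_right)
  \<comment> \<open>\<open>v\<close> gathers the factors near 1 and \<open>\<kappa>\<close> the
    exact rest. The last factor is not inverted, because it enters through
    \<open>fact (D p^3)\<close> divided by the smaller factorial.\<close>
  define v where "v = T / of_nat (N choose R) * W (of_nat N) n * inverse (W (of_nat R) r) * W (- of_nat D) d"
  define \<kappa> :: rat where "\<kappa> = (-1) ^ (r - n + 1) * ((of_nat N - of_nat R) / of_nat r)
      * inverse (of_nat ((r - 1) choose n))"
  have "cubic_cong v (of_int (wolst p) * of_nat N * of_nat R * (of_nat N - of_nat R) + of_nat N * H1 n
      + - (of_nat R * H1 r) + - of_nat D * H1 d)"
    unfolding T_def v_def using assms d
    by (intro cubic_cong_mult cubic_cong_inverse W cubic_cong_binomial_mult_p_cubed p_integral_minus) auto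
  then have "pcong p 3 v 1" by (rule cubic_cong_pcong_1)
  then obtain z where z: "p_integral p z" "v = 1 + of_nat p ^ 3 * z" by (elim pcongE)
  \<comment> \<open>Integrality of \<open>\<kappa>\<close>: its inverted binomial coefficient
    divides \<open>fact (r - 1)\<close>, which is prime to p as \<open>r - 1 < p\<close>.\<close>
  have "\<not> p dvd fact (r - 1)" using prime_dvd_fact_iff[OF p, of "r - 1"] assms by simp
  moreover have "((r - 1) choose n) dvd fact (r - 1)"
    using binomial_fact_lemma[of n "r - 1"] assms by (metis Suc_leI Suc_pred' dvd_triv_right less_nat_zero_code not_less_eq_eq not_gr_zero)
  ultimately have "\<not> int p dvd int ((r - 1) choose n)" using dvd_trans int_dvd_int_iff by blast
  from p_integral_inverse_of_int[OF this]
  have "p_integral p (inverse (of_nat ((r - 1) choose n)))" by simp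
  then have \<kappa>: "p_integral p \<kappa>"
    unfolding \<kappa>_def using assms
    by (intro p_integral_mult p_integral_power p_integral_divide_of_nat p_integral_diff)
      (auto intro: p_integral_minus)
  have "of_nat ((N * p ^ 3 + n) choose (R * p ^ 3 + r)) / of_nat (N choose R) = v * (\<kappa> * of_nat p ^ 3)"
  proof -
    have "N * p ^ 3 - R * p ^ 3 = D * p ^ 3" by (simp add: D_def diff_mult_distrib)
    then have T: "T = fact (N * p ^ 3) / (fact (R * p ^ 3) * fact (D * p ^ 3))"
      using assms(2) by (simp add: T_def binomial_fact)
    have "N * p ^ 3 + n - (R * p ^ 3 + r) = D * p ^ 3 - Suc d"
      by (simp add: N d algebra_simps)
    moreover have "R * p ^ 3 + r \<le> N * p ^ 3 + n" using pD assms by (simp add: N algebra_simps)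
    ultimately have C: "(of_nat ((N * p ^ 3 + n) choose (R * p ^ 3 + r)) :: rat) =
        fact (N * p ^ 3) * fact n * W (of_nat N) n /
        (fact (R * p ^ 3) * fact r * W (of_nat R) r * fact (D * p ^ 3 - Suc d))"
      by (simp add: binomial_fact F)
    have "d < D * p ^ 3" using pD assms d by simp
    from fact_diff_shifted_prod[OF this]
    have FD: "(fact (D * p ^ 3) :: rat) = fact (D * p ^ 3 - Suc d) * (of_nat D * of_nat p ^ 3)
        * (-1) ^ d * fact d * W (- of_nat D) d"
      by (simp add: W_def)
    have C': "(of_nat ((r - 1) choose n) :: rat) = fact (r - 1) / (fact n * fact d)"
      by (simp add: binomial_fact d)
    have fr: "(fact r :: rat) = of_nat r * fact (r - 1)" using assms by (simp add: fact_reduce)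
    \<comment> \<open>Here \<open>r - n + 1 = d + 2\<close>, so the parity is that of
      \<open>d\<close>.\<close>
    have "(-1 :: rat) ^ (r - n + 1) = (-1) ^ d" "(of_nat N - of_nat R :: rat) = of_nat D"
      by (simp_all add: d N)
    then have \<kappa>': "\<kappa> = (-1) ^ d * of_nat D * fact n * fact d / fact r"
      unfolding \<kappa>_def C' fr by simp
    define \<epsilon> :: rat where "\<epsilon> = (-1) ^ d"
    have "\<epsilon> \<noteq> 0" "of_nat D \<noteq> (0 :: rat)" "of_nat p \<noteq> (0 :: rat)"
      using D prime_gt_0_nat[OF p] by (simp_all add: \<epsilon>_def)
    moreover have "W (- of_nat D) d \<noteq> 0" using FD by (metis fact_nonzero mult_zero_right)
    ultimately show ?thesis
      unfolding C v_def T FD \<kappa>' \<epsilon>_def[symmetric] using nz[of N n] nz[of R r]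
      by (simp add: divide_simps)
  qed
  moreover have "v * (\<kappa> * of_nat p ^ 3) = \<kappa> * of_nat p ^ 3 + of_nat p ^ 5 * (of_nat p * z * \<kappa>)"
    unfolding z(2) by (simp add: algebra_simps eval_nat_numeral)
  ultimately show ?thesis
    unfolding \<kappa>_def[symmetric] using \<kappa> z
    by (intro pcongI[of _ "of_nat p * z * \<kappa>"] p_integral_intros) auto
qed

end

theorem theorem3p5:
  fixes p N R n r :: nat
  assumes "prime p" and "p \<ge> 7" and "N \<ge> R" and "n < p" and "r < p"
  shows "(r \<le> n \<longrightarrow>
            pcong p 5
              (of_nat ((N * p ^ 3 + n) choose (R * p ^ 3 + r))
                 / (of_nat (N choose R) * of_nat (n choose r)))
              (1 + c_coeff N R n r p * of_nat p ^ 3)) \<and>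
         (n < r \<longrightarrow>
            pcong p 5
              (of_nat ((N * p ^ 3 + n) choose (R * p ^ 3 + r)) / of_nat (N choose R))
              ((-1) ^ (r - n + 1) * ((of_nat N - of_nat R) / of_nat r)
                 * inverse (of_nat ((r - 1) choose n)) * of_nat p ^ 3))"
  using assms binomial_pcong_le binomial_pcong_gt by blast

end
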